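(* Let $(x^\star,w^\star,y^\star)$ be a saddle point of $\mathbb{L}$, and let $\{(u_k,x_k,w_k,y_k,\tau_k)\}_{k\ge1}$ be generated by Algorithm 1 (described in the context), under the standing assumption. Let $k_1\in\mathbb{N}$ be the natural number described in the context, and set $$A_0:=\frac{\psi}{\psi-1}\|u_{k_1+1}-x^\star\|_S^2+\|w^\star-w_{k_1-1}\|_{T_{k_1-1}}^2+\frac1\beta\|y^\star-y_{k_1-1}\|^2,\qquad N':=N-k_1+1,\qquad \underline{\tau}:=\min\Big\{\tau_0,\frac{\mu\sqrt{\lambda_{\min}(S)}}{\sqrt\beta\,\|A\|}\Big\}.$$ Then, for every $N\ge k_1$, there exists an index $j_N\in\{k_1,\dots,N\}$ such that $$\mathbb{L}(x_{j_N},w_{j_N},y^\star)-\Phi^\star\le\frac{A_0}{2\underline\tau\,N'},$$ $$\|r^p_{j_N}\|\le\sqrt{\frac{A_0}{\beta\underline\tau^2(1-\mu)N'}},$$ $$\operatorname{dist}\big(0,\partial f(w_{j_N})+B^\top y_{j_N}\big)\le\sqrt{\frac{A_0\|T\|}{\underline\tau\,N'}},$$ $$\operatorname{dist}\big(0,\partial g(x_{j_N})+A^\top y_{j_N}\big)\le\sqrt{\frac1{N'}\left(\frac{2A_0\psi\|S\|\tau_0}{\underline\tau^3}+\frac{2A_0\beta\|A\|^2}{1-\mu}\right)}.$$ Consequently, there exists a constant $C_{\rm prm}>0$ such that $\mathcal{R}_{j_N}\le\frac{C_{\rm prm}}{N'}$, where $$C_{\rm prm}:=A_0\left(\frac{1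}{\beta\underline\tau^2(1-\mu)}+\frac{\|T\|}{\underline\tau}+\frac{2\psi\|S\|\tau_0}{\underline\tau^3}+\frac{2\beta\|A\|^2}{1-\mu}\right).$$
   Context: **Problem.** $g:\mathbb{R}^q\to\mathbb{R}\cup\{+\infty\}$ and $f:\mathbb{R}^p\to\mathbb{R}\cup\{+\infty\}$ are proper, closed, convex functions, $A\in\mathbb{R}^{m\times q}$, $B\in\mathbb{R}^{m\times p}$, $b\in\mathbb{R}^m$. The problem is $\min_{x\in\mathbb{R}^q,\,w\in\mathbb{R}^p} g(x)+f(w)$ subject to $Ax+Bw=b$. Set $\Phi(x,w):=g(x)+f(w)$, $\Phi^\star:=\min\{\Phi(x,w):Ax+Bw=b\}$, $\mathbb{L}(x,w,y):=\Phi(x,w)+\langle y,Ax+Bw-b\rangle$ and, for $\sigma>0$, $\mathbb{L}_\sigma(x,w,y):=\mathbb{L}(x,w,y)+\frac{\sigma}{2}\|Ax+Bw-b\|^2$. A triple $(x^\star,w^\star,y^\star)$ is a saddle point of $\mathbb{L}$ if $\mathbb{L}(x^\star,w^\star,y)\le\mathbb{L}(x^\star,w^\star,y^\star)\le\mathbb{L}(x,w,y^\star)$ for all $(x,w,y)\in\mathbb{R}^q\times\mathbb{R}^p\times\mathbb{R}^m$. **Standing assumption.** The solution set of the problem is nonempty, and there exist $\tilde x\in\operatorname{ri}(\operatorname{dom} g)$ and $\tilde w\in\operatorname{ri}(\operatorname{dom} f)$ with $A\tilde x+B\tilde w=b$ ($\operatorname{ri}$ = relative interior). **Notation.** $\mathbb{N}=\{1,2,\dots\}$.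 $\|\cdot\|$ is the Euclidean norm on vectors and the operator (spectral) norm on matrices. For a symmetric positive semidefinite $M$, $\|y\|_M:=\sqrt{y^\top My}$. $\lambda_{\min}(M)$ is the smallest eigenvalue of $M$. $\partial h$ is the convex subdifferential. $\operatorname{dist}(z,C):=\inf_{u\in C}\|z-u\|$. $\varphi:=\frac{1+\sqrt5}{2}$. If $A=0$, the quotient with $\|A\|$ in its denominator is read as $+\infty$. **Algorithm 1.** Let $S\in\mathbb{R}^{q\times q}$ and $T\in\mathbb{R}^{p\times p}$ be symmetric positive definite, $x_0\in\mathbb{R}^q$, $w_0\in\mathbb{R}^p$, $y_0\in\mathbb{R}^m$, $u_0=x_0$, $\tau_0>0$, $\beta>0$, $\psi\in(1,\varphi]$, $0<\mu<\frac{\psi}{2}$. For $k=1,2,\dots$: $$u_k=\tfrac{\psi-1}{\psi}x_{k-1}+\tfrac1\psi u_{k-1},\qquad x_k=\arg\min_x\Big\{\mathbb{L}(x,w_{k-1},y_{k-1})+\tfrac{1}{2\tau_{k-1}}\|x-u_k\|_S^2\Big\},$$ $$\tau_k=\min\Big\{\tau_{k-1},\frac{\mu\sqrt{\lambda_{\min}(S)}}{\sqrt\beta\,L_k}\Big\},\qquad L_k:=\frac{\|Ax_k-Ax_{k-1}\|}{\|x_k-x_{k-1}\|},$$ with the convention that $\tau_k=\tau_{k-1}$ whenever $Ax_k=Ax_{k-1}$ (in particular whenever $x_k=x_{k-1}$), $$w_k=\arg\min_w\Big\{\mathbb{L}_{\beta\tau_k}(x_k,w,y_{k-1})+\tfrac12\|w-w_{k-1}\|_T^2\Big\},\qquad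 y_k=y_{k-1}+\beta\tau_k(Ax_k+Bw_k-b).$$ **The index $k_1$.** With $T_k:=\tau_kT$, $k_1\in\mathbb{N}$ is a natural number such that for all $k\ge k_1$ and all $y\in\mathbb{R}^m$ $$\begin{aligned}2\tau_k\big(\mathbb{L}(x_k,w_k,y)-\Phi^\star\big)\le{}&\tfrac{\psi}{\psi-1}\big(\|u_{k+1}-x^\star\|_S^2-\|u_{k+2}-x^\star\|_S^2\big)+\big(\|w^\star-w_{k-1}\|_{T_{k-1}}^2-\|w^\star-w_k\|_{T_k}^2\big)\\&+\tfrac1\beta\big(\|y-y_{k-1}\|^2-\|y-y_k\|^2\big)-\|w_k-w_{k-1}\|_{T_k}^2\\&-\tfrac1\beta(1-\mu)\|y_k-y_{k-1}\|^2-\tfrac{\psi\tau_k}{\tau_{k-1}}\|x_k-u_{k+1}\|_S^2.\end{aligned}$$ Such a $k_1$ always exists. **Residuals.** $r_k^p:=Ax_k+Bw_k-b$ and $$\mathcal{R}_k:=\|r_k^p\|^2+\operatorname{dist}^2\big(0,\partial g(x_k)+A^\top y_k\big)+\operatorname{dist}^2\big(0,\partial f(w_k)+B^\top y_k\big).$$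
   Formalization: The explicit C_prm is 0 when A_0 = 0 (e.g. when started at the saddle point), so C_prm > 0 is claimed only for A_0 > 0; the bound with the explicit C_prm is proved always, and for A_0 = 0 some other positive constant is given. *)

theory Defs
  imports "HOL-Analysis.Analysis"
begin

section \<open>Extended-real convex functions\<close>

definition epi :: "('a \<Rightarrow> ereal) \<Rightarrow> ('a \<times> real) set" where
  "epi h = {(x, t). h x \<le> ereal t}"

definition edom :: "('a \<Rightarrow> ereal) \<Rightarrow> 'a set" where
  "edom h = {x. h x < \<infinity>}"

definition proper_fun :: "('a \<Rightarrow> ereal) \<Rightarrow> bool" where
  "proper_fun h \<longleftrightarrow> (\<forall>x. h x \<noteq> -\<infinity>) \<and> edom h \<noteq> {}"

definition closed_fun :: "('a::topological_space \<Rightarrow> ereal) \<Rightarrow> bool" where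
  "closed_fun h \<longleftrightarrow> closed (epi h)"

definition convex_fun :: "('a::real_vector \<Rightarrow> ereal) \<Rightarrow> bool" where
  "convex_fun h \<longleftrightarrow> convex (epi h)"

text \<open>For proper \<open>h\<close> the set below is empty when \<open>h x = \<infinity>\<close>, as it should be.\<close>

definition subdifferential :: "('a::real_inner \<Rightarrow> ereal) \<Rightarrow> 'a \<Rightarrow> 'a set" where
  "subdifferential h x = {v. \<forall>z. h x + ereal (v \<bullet> (z - x)) \<le> h z}"

text \<open>The distance is extended-real valued, so that the distance to the empty set is \<open>\<infinity>\<close>;
  \<open>infdist\<close> would give \<open>0\<close> there.\<close>

definition edist :: "'a::real_normed_vector \<Rightarrow> 'a set \<Rightarrow> ereal" where
  "edist z C = (INF u\<in>C. ereal (norm (z - u)))"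

section \<open>Matrices\<close>

definition spd :: "real^'n^'n \<Rightarrow> bool" where
  "spd M \<longleftrightarrow> transpose M = M \<and> (\<forall>v. v \<noteq> 0 \<longrightarrow> 0 < v \<bullet> (M *v v))"

definition mnorm :: "real^'n^'n \<Rightarrow> real^'n \<Rightarrow> real" where
  "mnorm M v = sqrt (v \<bullet> (M *v v))"

definition opnorm :: "real^'n^'m \<Rightarrow> real" where
  "opnorm M = onorm (\<lambda>v. M *v v)"

definition eigenvalue_of :: "real^'n^'n \<Rightarrow> real \<Rightarrow> bool" where
  "eigenvalue_of M l \<longleftrightarrow> (\<exists>v. v \<noteq> 0 \<and> M *v v = l *\<^sub>R v)"

definition lambda_min :: "real^'n^'n \<Rightarrow> real" where
  "lambda_min M = (LEAST l. eigenvalue_of M l)"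

section \<open>The problem\<close>

definition objective :: "(real^'q \<Rightarrow> ereal) \<Rightarrow> (real^'p \<Rightarrow> ereal) \<Rightarrow> real^'q \<Rightarrow> real^'p \<Rightarrow> ereal" where
  "objective g f x w = g x + f w"

definition feasible :: "real^'q^'m \<Rightarrow> real^'p^'m \<Rightarrow> real^'m \<Rightarrow> ((real^'q) \<times> (real^'p)) set" where
  "feasible A B b = {(x, w). A *v x + B *v w = b}"

definition opt_value ::
  "(real^'q \<Rightarrow> ereal) \<Rightarrow> (real^'p \<Rightarrow> ereal) \<Rightarrow> real^'q^'m \<Rightarrow> real^'p^'m \<Rightarrow> real^'m \<Rightarrow> ereal" where
  "opt_value g f A B b = (INF (x, w) \<in> feasible A B b. objective g f x w)"

definition solution_set ::
  "(real^'q \<Rightarrow> ereal) \<Rightarrow> (real^'p \<Rightarrow> ereal) \<Rightarrow> real^'q^'m \<Rightarrow> real^'p^'m \<Rightarrow> real^'m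
    \<Rightarrow> ((real^'q) \<times> (real^'p)) set" where
  "solution_set g f A B b =
     {(x, w). (x, w) \<in> feasible A B b \<and> objective g f x w = opt_value g f A B b}"

definition lagrangian ::
  "(real^'q \<Rightarrow> ereal) \<Rightarrow> (real^'p \<Rightarrow> ereal) \<Rightarrow> real^'q^'m \<Rightarrow> real^'p^'m \<Rightarrow> real^'m
    \<Rightarrow> real^'q \<Rightarrow> real^'p \<Rightarrow> real^'m \<Rightarrow> ereal" where
  "lagrangian g f A B b x w y = objective g f x w + ereal (y \<bullet> (A *v x + B *v w - b))"

definition aug_lagrangian ::
  "(real^'q \<Rightarrow> ereal) \<Rightarrow> (real^'p \<Rightarrow> ereal) \<Rightarrow> real^'q^'m \<Rightarrow> real^'p^'m \<Rightarrow> real^'m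
    \<Rightarrow> real \<Rightarrow> real^'q \<Rightarrow> real^'p \<Rightarrow> real^'m \<Rightarrow> ereal" where
  "aug_lagrangian g f A B b \<sigma> x w y =
     lagrangian g f A B b x w y + ereal (\<sigma> / 2 * (norm (A *v x + B *v w - b))\<^sup>2)"

definition saddle_point ::
  "(real^'q \<Rightarrow> ereal) \<Rightarrow> (real^'p \<Rightarrow> ereal) \<Rightarrow> real^'q^'m \<Rightarrow> real^'p^'m \<Rightarrow> real^'m
    \<Rightarrow> real^'q \<Rightarrow> real^'p \<Rightarrow> real^'m \<Rightarrow> bool" where
  "saddle_point g f A B b xs ws ys \<longleftrightarrow>
     (\<forall>x w y. lagrangian g f A B b xs ws y \<le> lagrangian g f A B b xs ws ys
            \<and> lagrangian g f A B b xs ws ys \<le> lagrangian g f A B b x w ys)"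

definition standing_assumption ::
  "(real^'q \<Rightarrow> ereal) \<Rightarrow> (real^'p \<Rightarrow> ereal) \<Rightarrow> real^'q^'m \<Rightarrow> real^'p^'m \<Rightarrow> real^'m \<Rightarrow> bool" where
  "standing_assumption g f A B b \<longleftrightarrow>
     solution_set g f A B b \<noteq> {} \<and>
     (\<exists>x \<in> rel_interior (edom g). \<exists>w \<in> rel_interior (edom f). A *v x + B *v w = b)"

section \<open>The algorithm\<close>

text \<open>
  The \<open>x\<close>-step minimizes \<open>L(x, w\<^sub>k\<^sub>-\<^sub>1, y\<^sub>k\<^sub>-\<^sub>1) + \<parallel>x - u\<^sub>k\<parallel>\<^sub>S\<^sup>2 / (2 \<tau>\<^sub>k\<^sub>-\<^sub>1)\<close> over \<open>x\<close>. The term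
  \<open>f w\<^sub>k\<^sub>-\<^sub>1\<close> of \<open>L\<close> does not depend on \<open>x\<close> and is left out: for an arbitrary starting
  point \<open>w\<^sub>0\<close> it may be \<open>\<infinity>\<close>, and then the full objective would be constantly \<open>\<infinity>\<close> and every
  point would be a minimizer. Where \<open>f w\<^sub>k\<^sub>-\<^sub>1\<close> is finite, the minimizers are the same.
\<close>

definition x_objective ::
  "(real^'q \<Rightarrow> ereal) \<Rightarrow> real^'q^'m \<Rightarrow> real^'p^'m \<Rightarrow> real^'m \<Rightarrow> real^'q^'q
    \<Rightarrow> real \<Rightarrow> real^'q \<Rightarrow> real^'p \<Rightarrow> real^'m \<Rightarrow> real^'q \<Rightarrow> ereal" where
  "x_objective g A B b S \<tau> u w y x =
     g x + ereal (y \<bullet> (A *v x + B *v w - b)) + ereal (1 / (2 * \<tau>) * (mnorm S (x - u))\<^sup>2)"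

definition w_objective ::
  "(real^'q \<Rightarrow> ereal) \<Rightarrow> (real^'p \<Rightarrow> ereal) \<Rightarrow> real^'q^'m \<Rightarrow> real^'p^'m \<Rightarrow> real^'m \<Rightarrow> real^'p^'p
    \<Rightarrow> real \<Rightarrow> real^'q \<Rightarrow> real^'p \<Rightarrow> real^'m \<Rightarrow> real^'p \<Rightarrow> ereal" where
  "w_objective g f A B b T \<sigma> x wp y w =
     aug_lagrangian g f A B b \<sigma> x w y + ereal (1 / 2 * (mnorm T (w - wp))\<^sup>2)"

definition next_step :: "real^'q^'m \<Rightarrow> real^'q^'q \<Rightarrow> real \<Rightarrow> real \<Rightarrow> real \<Rightarrow> real^'q \<Rightarrow> real^'q \<Rightarrow> real" where
  "next_step A S \<mu> \<beta> \<tau> xp x =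
     (if A *v x = A *v xp then \<tau>
      else min \<tau> (\<mu> * sqrt (lambda_min S) /
                   (sqrt \<beta> * (norm (A *v x - A *v xp) / norm (x - xp)))))"

definition algorithm_params :: "real^'q^'q \<Rightarrow> real^'p^'p \<Rightarrow> real \<Rightarrow> real \<Rightarrow> real \<Rightarrow> real \<Rightarrow> bool" where
  "algorithm_params S T \<tau>0 \<beta> \<psi> \<mu> \<longleftrightarrow>
     spd S \<and> spd T \<and> 0 < \<tau>0 \<and> 0 < \<beta> \<and> 1 < \<psi> \<and> \<psi> \<le> (1 + sqrt 5) / 2 \<and> 0 < \<mu> \<and> \<mu> < \<psi> / 2"

definition generated_by_algorithm ::
  "(real^'q \<Rightarrow> ereal) \<Rightarrow> (real^'p \<Rightarrow> ereal) \<Rightarrow> real^'q^'m \<Rightarrow> real^'p^'m \<Rightarrow> real^'m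
    \<Rightarrow> real^'q^'q \<Rightarrow> real^'p^'p \<Rightarrow> real \<Rightarrow> real \<Rightarrow> real
    \<Rightarrow> (nat \<Rightarrow> real^'q) \<Rightarrow> (nat \<Rightarrow> real^'q) \<Rightarrow> (nat \<Rightarrow> real^'p) \<Rightarrow> (nat \<Rightarrow> real^'m) \<Rightarrow> (nat \<Rightarrow> real)
    \<Rightarrow> bool" where
  "generated_by_algorithm g f A B b S T \<beta> \<psi> \<mu> u x w y \<tau> \<longleftrightarrow>
     algorithm_params S T (\<tau> 0) \<beta> \<psi> \<mu> \<and>
     u 0 = x 0 \<and>
     (\<forall>k\<ge>1.
        u k = ((\<psi> - 1) / \<psi>) *\<^sub>R x (k - 1) + (1 / \<psi>) *\<^sub>R u (k - 1) \<and>
        is_arg_min (x_objective g A B b S (\<tau> (k - 1)) (u k) (w (k - 1)) (y (k - 1)))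
          (\<lambda>_. True) (x k) \<and>
        \<tau> k = next_step A S \<mu> \<beta> (\<tau> (k - 1)) (x (k - 1)) (x k) \<and>
        is_arg_min (w_objective g f A B b T (\<beta> * \<tau> k) (x k) (w (k - 1)) (y (k - 1)))
          (\<lambda>_. True) (w k) \<and>
        y k = y (k - 1) + (\<beta> * \<tau> k) *\<^sub>R (A *v x k + B *v w k - b))"

section \<open>The descent inequality, the step size bound and the residuals\<close>

definition descent_from ::
  "(real^'q \<Rightarrow> ereal) \<Rightarrow> (real^'p \<Rightarrow> ereal) \<Rightarrow> real^'q^'m \<Rightarrow> real^'p^'m \<Rightarrow> real^'m
    \<Rightarrow> real^'q^'q \<Rightarrow> real^'p^'p \<Rightarrow> real \<Rightarrow> real \<Rightarrow> real
    \<Rightarrow> (nat \<Rightarrow> real^'q) \<Rightarrow> (nat \<Rightarrow> real^'q) \<Rightarrow> (nat \<Rightarrow> real^'p) \<Rightarrow> (nat \<Rightarrow> real^'m) \<Rightarrow> (nat \<Rightarrow> real)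
    \<Rightarrow> real^'q \<Rightarrow> real^'p \<Rightarrow> nat \<Rightarrow> bool" where
  "descent_from g f A B b S T \<beta> \<psi> \<mu> u x w y \<tau> xs ws k1 \<longleftrightarrow>
     (\<forall>k\<ge>k1. \<forall>z.
        ereal (2 * \<tau> k) * (lagrangian g f A B b (x k) (w k) z - opt_value g f A B b)
        \<le> ereal
           (\<psi> / (\<psi> - 1) * ((mnorm S (u (k + 1) - xs))\<^sup>2 - (mnorm S (u (k + 2) - xs))\<^sup>2)
            + ((mnorm (\<tau> (k - 1) *\<^sub>R T) (ws - w (k - 1)))\<^sup>2 - (mnorm (\<tau> k *\<^sub>R T) (ws - w k))\<^sup>2)
            + 1 / \<beta> * ((norm (z - y (k - 1)))\<^sup>2 - (norm (z - y k))\<^sup>2)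
            - (mnorm (\<tau> k *\<^sub>R T) (w k - w (k - 1)))\<^sup>2
            - 1 / \<beta> * (1 - \<mu>) * (norm (y k - y (k - 1)))\<^sup>2
            - \<psi> * \<tau> k / \<tau> (k - 1) * (mnorm S (x k - u (k + 1)))\<^sup>2))"

definition tau_lower :: "real^'q^'m \<Rightarrow> real^'q^'q \<Rightarrow> real \<Rightarrow> real \<Rightarrow> real \<Rightarrow> real" where
  "tau_lower A S \<mu> \<beta> \<tau>0 =
     (if A = 0 then \<tau>0 else min \<tau>0 (\<mu> * sqrt (lambda_min S) / (sqrt \<beta> * opnorm A)))"

definition dual_dist :: "(real^'n \<Rightarrow> ereal) \<Rightarrow> real^'n^'m \<Rightarrow> real^'n \<Rightarrow> real^'m \<Rightarrow> ereal" where
  "dual_dist h M z y = edist 0 ((\<lambda>v. v + transpose M *v y) ` subdifferential h z)"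

definition residual ::
  "(real^'q \<Rightarrow> ereal) \<Rightarrow> (real^'p \<Rightarrow> ereal) \<Rightarrow> real^'q^'m \<Rightarrow> real^'p^'m \<Rightarrow> real^'m
    \<Rightarrow> real^'q \<Rightarrow> real^'p \<Rightarrow> real^'m \<Rightarrow> ereal" where
  "residual g f A B b x w y =
     ereal ((norm (A *v x + B *v w - b))\<^sup>2) + (dual_dist g A x y)\<^sup>2 + (dual_dist f B w y)\<^sup>2"

end

theory Submission
  imports Defs
begin

text \<open>
  Summing the descent inequality at \<open>y = y\<^sup>\<star>\<close> telescopes to \<open>A\<^sub>0\<close>. At a saddle point the Lagrangian gap is
  nonnegative, so each summand is a sum of nonnegative terms and some index \<open>j\<close> makes all of these terms
  simultaneously at most \<open>A\<^sub>0 / N'\<close>. Together with \<open>\<tau>\<^sub>j \<ge> \<tau>\<^sub>l\<^sub>o\<^sub>w\<close>, this controls the gap and, as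
  \<open>y\<^sub>j - y\<^sub>j\<^sub>-\<^sub>1 = \<beta>\<tau>\<^sub>j r\<^sub>j\<close>, the primal residual. Fermat's rule for the two subproblems gives the subgradients
  \<open>T (w\<^sub>j\<^sub>-\<^sub>1 - w\<^sub>j) \<in> \<partial>f(w\<^sub>j) + B\<^sup>T y\<^sub>j\<close> and
  \<open>S (u\<^sub>j - x\<^sub>j) / \<tau>\<^sub>j\<^sub>-\<^sub>1 + A\<^sup>T (y\<^sub>j - y\<^sub>j\<^sub>-\<^sub>1) \<in> \<partial>g(x\<^sub>j) + A\<^sup>T y\<^sub>j\<close>, whose norms are bounded through
  \<open>\<parallel>M v\<parallel>\<^sup>2 \<le> \<parallel>M\<parallel> \<parallel>v\<parallel>\<^sub>M\<^sup>2\<close> and \<open>x\<^sub>j - u\<^sub>j = \<psi> (x\<^sub>j - u\<^sub>j\<^sub>+\<^sub>1)\<close>.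
\<close>

section \<open>Operator norms, positive definite forms and the smallest eigenvalue\<close>

lemma inner_transpose_mult:
  fixes M :: "real^'n^'m"
  shows "(transpose M *v v) \<bullet> z = v \<bullet> (M *v z)"
  by (simp add: transpose_matrix_vector dot_lmul_matrix)

lemma norm_matrix_mult_le: "norm (M *v v) \<le> opnorm M * norm v"
  for M :: "real^'n^'m"
  unfolding opnorm_def by (rule onorm[OF matrix_vector_mul_bounded_linear])

lemma opnorm_nonneg: "0 \<le> opnorm M"
  for M :: "real^'n^'m"
  unfolding opnorm_def by (rule onorm_pos_le[OF matrix_vector_mul_bounded_linear])

text \<open>With z the transposed image of v, the square of \<open>norm z\<close> equals v paired
  with M z; Cauchy-Schwarz and one cancelled factor \<open>norm z\<close> give the bound. It lets
  the dual residual be estimated by \<open>opnorm A\<close> itself.\<close>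

lemma norm_transpose_mult_le: "norm (transpose M *v v) \<le> opnorm M * norm v"
  for M :: "real^'n^'m"
proof (cases "transpose M *v v = 0")
  case True
  then show ?thesis by (simp add: opnorm_nonneg)
next
  case False
  let ?z = "transpose M *v v"
  have "norm ?z * norm ?z = v \<bullet> (M *v ?z)"
    by (metis inner_transpose_mult norm_eq_sqrt_inner power2_eq_square power2_norm_eq_inner)
  also have "\<dots> \<le> norm v * norm (M *v ?z)"
    by (rule norm_cauchy_schwarz)
  also have "\<dots> \<le> norm v * (opnorm M * norm ?z)"
    by (intro mult_left_mono norm_matrix_mult_le) simp
  finally have "norm ?z * norm ?z \<le> (opnorm M * norm v) * norm ?z"
    by (simp add: mult_ac)
  then show ?thesis using False by simp
qed

lemma spd_inner_nonneg: "spd M \<Longrightarrow> 0 \<le> v \<bullet> (M *v v)"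
  by (cases "v = 0") (auto simp: spd_def less_imp_le)

lemma mnorm_scaleR_power2:
  assumes "spd M" "0 \<le> c"
  shows "(mnorm (c *\<^sub>R M) v)\<^sup>2 = c * (v \<bullet> (M *v v))"
  using assms spd_inner_nonneg[of M v]
  by (simp add: mnorm_def scaleR_matrix_vector_assoc[symmetric])

lemma mnorm_power2: "spd M \<Longrightarrow> (mnorm M v)\<^sup>2 = v \<bullet> (M *v v)"
  using spd_inner_nonneg[of M v] by (simp add: mnorm_def)

text \<open>Symmetry merges the two cross terms. The right side is grouped by powers of t so that it
  fits the expansion demanded by \<open>minimizer_subgradient\<close>.\<close>

lemma quadratic_form_line:
  fixes M :: "real^'n^'n"
  assumes "transpose M = M"
  shows "(v + t *\<^sub>R d) \<bullet> (M *v (v + t *\<^sub>R d))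
    = v \<bullet> (M *v v) + t * (2 * (d \<bullet> (M *v v))) + t\<^sup>2 * (d \<bullet> (M *v d))"
proof -
  have "v \<bullet> (M *v d) = d \<bullet> (M *v v)"
    using inner_transpose_mult[of M d v] unfolding assms by (simp only: inner_commute)
  then show ?thesis
    unfolding matrix_vector_right_distrib matrix_vector_mult_scaleR inner_add_left inner_add_right
    by (simp add: power2_eq_square)
qed

text \<open>Converts the weighted norms of the descent inequality into norms of subgradients at the
  cost of a single factor \<open>opnorm M\<close>, without involving the smallest
  eigenvalue.\<close>

lemma norm_spd_mult_power2_le:
  assumes "spd M"
  shows "(norm (M *v v))\<^sup>2 \<le> opnorm M * (v \<bullet> (M *v v))"
proof (cases "opnorm M = 0")
  case True
  then show ?thesis using norm_matrix_mult_le[of M v] by simp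
next
  case False
  define a L where "a = M *v v" and "L = opnorm M"
  have L: "0 < L" using False opnorm_nonneg[of M] by (simp add: L_def)
  have sym: "transpose M = M" using assms by (simp add: spd_def)
  have "a \<bullet> (M *v a) \<le> norm a * norm (M *v a)"
    by (rule norm_cauchy_schwarz)
  also have "\<dots> \<le> norm a * (L * norm a)"
    unfolding L_def by (intro mult_left_mono norm_matrix_mult_le) simp
  finally have aMa: "a \<bullet> (M *v a) \<le> L * (norm a)\<^sup>2"
    by (simp add: power2_eq_square mult_ac)
  \<comment> \<open>The step \<open>-1/L\<close> along the gradient direction \<open>a\<close> minimizes the upper bound on the form.\<close>
  have "0 \<le> (v + (-1/L) *\<^sub>R a) \<bullet> (M *v (v + (-1/L) *\<^sub>R a))"
    by (rule spd_inner_nonneg[OF assms])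
  also have "\<dots> = v \<bullet> (M *v v) + (-1/L) * (2 * (a \<bullet> (M *v v))) + (-1/L)\<^sup>2 * (a \<bullet> (M *v a))"
    by (rule quadratic_form_line[OF sym])
  also have "\<dots> \<le> v \<bullet> (M *v v) + (-1/L) * (2 * (a \<bullet> (M *v v))) + (-1/L)\<^sup>2 * (L * (norm a)\<^sup>2)"
    by (intro add_left_mono mult_left_mono aMa) simp
  also have "\<dots> = v \<bullet> (M *v v) - (norm a)\<^sup>2 / L"
    using L unfolding a_def[symmetric] by (simp add: dot_square_norm power2_eq_square diff_divide_distrib)
  finally show ?thesis
    using L unfolding a_def[symmetric] L_def[symmetric] by (simp add: pos_divide_le_eq mult.commute)
qed

text \<open>A \<open>LEAST\<close> over the reals says something only once a minimum exists.
  Compactness supplies one: the minimum l of the form on the unit sphere is positive, is an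
  eigenvalue by a first-variation argument, and bounds every other eigenvalue from below.\<close>

lemma lambda_min_pos:
  fixes M :: "real^'n^'n"
  assumes "spd M"
  shows "0 < lambda_min M"
proof -
  have sym: "transpose M = M" using assms by (simp add: spd_def)
  have "continuous_on (sphere 0 1) (\<lambda>v. v \<bullet> (M *v v))"
    by (intro continuous_intros linear_continuous_on matrix_vector_mul_bounded_linear)
  moreover have "sphere (0::real^'n) 1 \<noteq> {}" by simp
  ultimately obtain v where v: "norm v = 1"
    and vmin: "\<And>z. norm z = 1 \<Longrightarrow> v \<bullet> (M *v v) \<le> z \<bullet> (M *v z)"
    using continuous_attains_inf[OF compact_sphere, of 0 1 "\<lambda>v. v \<bullet> (M *v v)"]
    by (auto simp: dist_norm)
  define l where "l = v \<bullet> (M *v v)"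
  have v0: "v \<noteq> 0" using v by auto
  have l_pos: "0 < l" using assms v0 by (simp add: l_def spd_def)
  have rayleigh: "l * (norm z)\<^sup>2 \<le> z \<bullet> (M *v z)" for z
  proof (cases "z = 0")
    case False
    have "l \<le> ((1 / norm z) *\<^sub>R z) \<bullet> (M *v ((1 / norm z) *\<^sub>R z))"
      unfolding l_def using False by (intro vmin) simp
    also have "\<dots> = (z \<bullet> (M *v z)) / (norm z)\<^sup>2"
      by (simp add: matrix_vector_mult_scaleR power2_eq_square)
    finally show ?thesis using False by (simp add: pos_le_divide_eq)
  qed simp
  \<comment> \<open>Along v + t d the form minus l times the squared norm is nonnegative and
    vanishes at t = 0, so its linear coefficient must be zero. Choosing d as the defect M v - l v
    itself then yields the eigenvector equation.\<close>
  have ortho: "d \<bullet> (M *v v - l *\<^sub>R v) = 0" for d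
  proof -
    define p e where "p = 2 * (d \<bullet> (M *v v - l *\<^sub>R v))" and "e = d \<bullet> (M *v d) - l * (norm d)\<^sup>2"
    have pe: "0 \<le> t * p + t\<^sup>2 * e" for t
    proof -
      have "0 \<le> (v + t *\<^sub>R d) \<bullet> (M *v (v + t *\<^sub>R d)) - l * (norm (v + t *\<^sub>R d))\<^sup>2"
        using rayleigh[of "v + t *\<^sub>R d"] by simp
      also have "\<dots> = t * p + t\<^sup>2 * e"
        unfolding quadratic_form_line[OF sym] p_def e_def power2_norm_eq_inner
        using v by (simp add: l_def[symmetric] inner_add_left inner_add_right inner_diff_right inner_commute
            power2_eq_square algebra_simps norm_eq_1)
      finally show ?thesis .
    qed
    have "p = 0"
    proof (rule ccontr)
      assume p: "p \<noteq> 0"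
      \<comment> \<open>This t makes the linear term negative and dominant over the quadratic one
        for either sign of e; adding 1 also covers e = 0.\<close>
      define t where "t = - p / (\<bar>e\<bar> + 1)"
      have eq: "t * p + t\<^sup>2 * e = p\<^sup>2 / (\<bar>e\<bar> + 1) * (e / (\<bar>e\<bar> + 1) - 1)"
        unfolding t_def by (simp add: power2_eq_square right_diff_distrib)
      have "e / (\<bar>e\<bar> + 1) - 1 < 0" by (simp add: divide_less_eq abs_if)
      moreover have "0 < p\<^sup>2 / (\<bar>e\<bar> + 1)" using p by simp
      ultimately have "t * p + t\<^sup>2 * e < 0"
        unfolding eq by (intro mult_pos_neg)
      with pe[of t] show False by simp
    qed
    then show ?thesis by (simp add: p_def)
  qed
  have "M *v v = l *\<^sub>R v"
    using ortho[of "M *v v - l *\<^sub>R v"] by simp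
  then have "eigenvalue_of M l"
    using v0 by (auto simp: eigenvalue_of_def)
  moreover have "l \<le> l'" if eig: "eigenvalue_of M l'" for l'
  proof -
    from eig obtain z where z: "z \<noteq> 0" "M *v z = l' *\<^sub>R z"
      by (auto simp: eigenvalue_of_def)
    then have "l * (norm z)\<^sup>2 \<le> l' * (norm z)\<^sup>2"
      using rayleigh[of z] by (simp add: dot_square_norm)
    then show ?thesis using z by simp
  qed
  ultimately have "lambda_min M = l"
    unfolding lambda_min_def by (rule Least_equality)
  then show ?thesis using l_pos by simp
qed

section \<open>Optimality conditions for the two subproblems\<close>

lemma convex_fun_line:
  assumes "convex_fun h" "h x \<le> ereal a" "h z \<le> ereal c" "0 \<le> t" "t \<le> 1"
  shows "h (x + t *\<^sub>R (z - x)) \<le> ereal (a + t * (c - a))"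
proof -
  have "(1 - t) *\<^sub>R (x, a) + t *\<^sub>R (z, c) \<in> epi h"
    using assms by (intro convexD) (auto simp: convex_fun_def epi_def)
  moreover have "(1 - t) *\<^sub>R (x, a) + t *\<^sub>R (z, c) = (x + t *\<^sub>R (z - x), a + t * (c - a))"
    by (simp add: algebra_simps)
  ultimately show ?thesis by (simp add: epi_def)
qed

lemma minimizer_finite:
  assumes h: "proper_fun h"
    and min: "is_arg_min F (\<lambda>_. True) x" and F: "\<And>z. F z = h z + ereal (q z)"
  shows "\<exists>r. h x = ereal r"
proof -
  obtain z where "h z < \<infinity>" using h by (auto simp: proper_fun_def edom_def)
  then have "F z < \<infinity>" by (simp add: F)
  moreover have "F x \<le> F z" using min by (auto simp: is_arg_min_def not_less)
  ultimately have "h x \<noteq> \<infinity>" by (auto simp: F)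
  then show ?thesis using h by (cases "h x") (auto simp: proper_fun_def)
qed

text \<open>Fermat's rule for a convex function plus a quadratic one; the expansion along lines encodes that
  \<open>c\<close> is the gradient of the quadratic part at \<open>x\<close>.\<close>

lemma minimizer_subgradient:
  assumes h: "proper_fun h" "convex_fun h"
    and min: "is_arg_min F (\<lambda>_. True) x" and F: "\<And>z. F z = h z + ereal (q z)"
    and q: "\<And>t d. q (x + t *\<^sub>R d) = q x + t * (c \<bullet> d) + t\<^sup>2 * e d"
  shows "- c \<in> subdifferential h x"
proof -
  obtain r where r: "h x = ereal r"
    using minimizer_finite[OF h(1) min F] by blast
  have "h x + ereal (- c \<bullet> (z - x)) \<le> h z" for z
  proof (cases "h z")
    case (real s)
    let ?d = "z - x"
    have ineq: "r - s \<le> c \<bullet> ?d + t * e ?d" if t: "0 < t" "t \<le> 1" for t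
    proof -
      let ?zt = "x + t *\<^sub>R ?d"
      have "h x + ereal (q x) \<le> h ?zt + ereal (q ?zt)"
        using min by (auto simp: is_arg_min_def not_less F)
      also have "\<dots> \<le> ereal (r + t * (s - r)) + ereal (q ?zt)"
        using t r real by (intro add_right_mono convex_fun_line h) auto
      finally have "t * (r - s) \<le> t * (c \<bullet> ?d + t * e ?d)"
        by (simp only: r q) (simp add: algebra_simps power2_eq_square)
      then show ?thesis using t by simp
    qed
    \<comment> \<open>Minimality along the segment, bounded by convexity and divided by t, leaves
      the second-order part multiplied by t; it disappears as t decreases to 0.\<close>
    have "((\<lambda>t. c \<bullet> ?d + t * e ?d) \<longlongrightarrow> c \<bullet> ?d + 0 * e ?d) (at_right 0)"
      by (intro tendsto_intros)
    moreover have "\<forall>\<^sub>F t in at_right 0. r - s \<le> c \<bullet> ?d + t * e ?d"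
      unfolding eventually_at_right_field using ineq by (intro exI[of _ 1]) auto
    ultimately have "r - s \<le> c \<bullet> ?d + 0 * e ?d"
      by (intro tendsto_lowerbound) auto
    then show ?thesis by (simp add: r real)
  qed (use h in \<open>auto simp: proper_fun_def\<close>)
  then show ?thesis by (simp add: subdifferential_def)
qed

lemma dual_dist_le:
  assumes "v \<in> subdifferential h z"
  shows "dual_dist h M z y \<le> ereal (norm (v + transpose M *v y))"
proof -
  have "norm (0 - (v + transpose M *v y)) = norm (v + transpose M *v y)"
    by (metis diff_0 norm_minus_cancel)
  then show ?thesis
    unfolding dual_dist_def edist_def using assms
    by (intro INF_lower2[of "v + transpose M *v y"]) auto
qed

lemma dual_dist_nonneg: "0 \<le> dual_dist h M z y"
  unfolding dual_dist_def edist_def by (intro INF_greatest) auto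

text \<open>The first claim is Fermat's rule with the gradient of the linear and proximal terms.
  Finiteness of \<open>g x\<close> is recorded because \<open>g x\<close> enters the objective of
  the w-step as a constant.\<close>

lemma x_step_subgradient:
  assumes g: "proper_fun g" "convex_fun g" and S: "spd S"
    and min: "is_arg_min (x_objective g A B b S \<tau> u w y) (\<lambda>_. True) x"
  shows "- (transpose A *v y + (1 / \<tau>) *\<^sub>R (S *v (x - u))) \<in> subdifferential g x"
    and "\<exists>r. g x = ereal r"
proof -
  define q where
    "q z = y \<bullet> (A *v z + B *v w - b) + 1 / (2 * \<tau>) * ((z - u) \<bullet> (S *v (z - u)))" for z
  have F: "x_objective g A B b S \<tau> u w y z = g z + ereal (q z)" for z
    by (simp add: x_objective_def q_def mnorm_power2[OF S] add.assoc)
  have sym: "transpose S = S" using S by (simp add: spd_def)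
  have "q (x + t *\<^sub>R d) = q x + t * ((transpose A *v y + (1 / \<tau>) *\<^sub>R (S *v (x - u))) \<bullet> d)
      + t\<^sup>2 * (1 / (2 * \<tau>) * (d \<bullet> (S *v d)))" for t d
  proof -
    have "(x + t *\<^sub>R d) - u = (x - u) + t *\<^sub>R d" by simp
    then show ?thesis
      unfolding q_def by (simp only: quadratic_form_line[OF sym])
        (simp add: dot_lmul_matrix matrix_vector_right_distrib matrix_vector_mult_scaleR
          inner_add_left inner_add_right inner_diff_right inner_commute[of d] algebra_simps add_divide_distrib)
  qed
  then show "- (transpose A *v y + (1 / \<tau>) *\<^sub>R (S *v (x - u))) \<in> subdifferential g x"
    by (rule minimizer_subgradient[OF g min F])
  show "\<exists>r. g x = ereal r"
    by (rule minimizer_finite[OF g(1) min F])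
qed

text \<open>The penalty contributes \<sigma> times the primal residual to the multiplier, which is
  exactly the dual update when \<sigma> = \<beta> \<tau>_k; so the new y appears in the optimality
  condition. If \<open>g x\<close> were infinite, the objective would be constantly infinite and
  minimality would say nothing.\<close>

lemma w_step_subgradient:
  assumes f: "proper_fun f" "convex_fun f" and T: "spd T" and gx: "g x = ereal r"
    and min: "is_arg_min (w_objective g f A B b T \<sigma> x wp y) (\<lambda>_. True) w"
  shows "- (transpose B *v (y + \<sigma> *\<^sub>R (A *v x + B *v w - b)) + T *v (w - wp)) \<in> subdifferential f w"
proof -
  define q where "q z = r + y \<bullet> (A *v x + B *v z - b) + \<sigma> / 2 * (norm (A *v x + B *v z - b))\<^sup>2
      + 1 / 2 * ((z - wp) \<bullet> (T *v (z - wp)))" for z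
  have F: "w_objective g f A B b T \<sigma> x wp y z = f z + ereal (q z)" for z
    by (cases "f z") (simp_all add: w_objective_def aug_lagrangian_def lagrangian_def objective_def
        q_def mnorm_power2[OF T] gx)
  have sym: "transpose T = T" using T by (simp add: spd_def)
  have "q (w + t *\<^sub>R d)
      = q w + t * ((transpose B *v (y + \<sigma> *\<^sub>R (A *v x + B *v w - b)) + T *v (w - wp)) \<bullet> d)
      + t\<^sup>2 * (\<sigma> / 2 * (norm (B *v d))\<^sup>2 + 1 / 2 * (d \<bullet> (T *v d)))" for t d
  proof -
    define v where "v = A *v x + B *v w - b"
    have "(w + t *\<^sub>R d) - wp = (w - wp) + t *\<^sub>R d" by simp
    moreover have "A *v x + B *v (w + t *\<^sub>R d) - b = v + t *\<^sub>R (B *v d)"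
      by (simp add: v_def matrix_vector_right_distrib matrix_vector_mult_scaleR)
    moreover have "(norm (v + t *\<^sub>R (B *v d)))\<^sup>2
        = (norm v)\<^sup>2 + t * (2 * (v \<bullet> (B *v d))) + t\<^sup>2 * (norm (B *v d))\<^sup>2"
      unfolding power2_norm_eq_inner
      by (simp add: inner_add_left inner_add_right inner_commute power2_eq_square)
    ultimately show ?thesis
      unfolding q_def v_def[symmetric] by (simp only: quadratic_form_line[OF sym])
        (simp add: inner_transpose_mult inner_add_left inner_add_right inner_commute[of d]
          algebra_simps add_divide_distrib del: transpose_matrix_vector)
  qed
  then show ?thesis
    by (rule minimizer_subgradient[OF f min F])
qed

section \<open>Lower bound on the step sizes\<close>

lemma tau_lower_pos:
  assumes "spd S" "0 < \<mu>" "0 < \<beta>" "0 < \<tau>0"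
  shows "0 < tau_lower A S \<mu> \<beta> \<tau>0"
proof (cases "A = 0")
  case False
  then have "opnorm A \<noteq> 0"
    unfolding opnorm_def onorm_eq_0[OF matrix_vector_mul_bounded_linear]
    by (metis matrix_eq matrix_vector_mult_0)
  then have "0 < opnorm A" using opnorm_nonneg[of A] by simp
  then show ?thesis
    using assms lambda_min_pos[OF assms(1)] False by (simp add: tau_lower_def)
qed (use assms in \<open>simp add: tau_lower_def\<close>)

lemma tau_lower_le: "tau_lower A S \<mu> \<beta> \<tau>0 \<le> \<tau>0"
  by (simp add: tau_lower_def)

text \<open>The local quotient L_k never exceeds the operator norm of A, so the candidate step is at
  least the one formed with \<open>opnorm A\<close>. This is the induction step for a bound uniform
  in k.\<close>

lemma tau_lower_le_next_step:
  assumes "spd S" "0 < \<mu>" "0 < \<beta>" and \<tau>: "tau_lower A S \<mu> \<beta> \<tau>0 \<le> \<tau>"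
  shows "tau_lower A S \<mu> \<beta> \<tau>0 \<le> next_step A S \<mu> \<beta> \<tau> xp x"
proof (cases "A *v x = A *v xp")
  case False
  then have A0: "A \<noteq> 0" and ne: "x \<noteq> xp" by auto
  let ?L = "norm (A *v x - A *v xp) / norm (x - xp)"
  have L_pos: "0 < ?L" using False ne by simp
  have L_le: "?L \<le> opnorm A"
    using norm_matrix_mult_le[of A "x - xp"] ne
    by (simp add: matrix_vector_mult_diff_distrib divide_le_eq)
  have "\<mu> * sqrt (lambda_min S) / (sqrt \<beta> * opnorm A) \<le> \<mu> * sqrt (lambda_min S) / (sqrt \<beta> * ?L)"
    using assms lambda_min_pos[OF assms(1)] L_pos L_le
    by (intro divide_left_mono mult_left_mono mult_pos_pos) auto
  then show ?thesis
    using \<tau> A0 False by (auto simp: next_step_def tau_lower_def)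
qed (use \<tau> in \<open>simp add: next_step_def\<close>)

section \<open>Saddle points and averaging\<close>

lemma saddle_point_feasible_finite:
  assumes g: "proper_fun g" and f: "proper_fun f"
    and sa: "standing_assumption g f A B b" and sp: "saddle_point g f A B b xs ws ys"
  shows "A *v xs + B *v ws = b" and "\<exists>r. objective g f xs ws = ereal r"
proof -
  \<comment> \<open>Relative interiors lie in the domains, so the Lagrangian is finite at this pair,
    and the right saddle inequality carries that over to (xs, ws).\<close>
  obtain x w where "x \<in> edom g" "w \<in> edom f"
    using sa unfolding standing_assumption_def by (meson rel_interior_subset subsetD)
  then have "lagrangian g f A B b x w ys < \<infinity>"
    by (auto simp: edom_def lagrangian_def objective_def)
  moreover have "lagrangian g f A B b xs ws ys \<le> lagrangian g f A B b x w ys"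
    using sp by (simp add: saddle_point_def)
  ultimately have "objective g f xs ws \<noteq> \<infinity>"
    by (auto simp: lagrangian_def)
  moreover have "objective g f xs ws \<noteq> -\<infinity>"
    using g f by (simp add: objective_def proper_fun_def)
  ultimately obtain r where r: "objective g f xs ws = ereal r"
    by (cases "objective g f xs ws") auto
  then show "\<exists>r. objective g f xs ws = ereal r" ..
  let ?v = "A *v xs + B *v ws - b"
  \<comment> \<open>Moving the multiplier along the constraint violation raises the Lagrangian by
    the squared violation, which maximality in y forbids unless it is zero.\<close>
  have "lagrangian g f A B b xs ws (ys + ?v) \<le> lagrangian g f A B b xs ws ys"
    using sp by (simp add: saddle_point_def)
  then have "?v \<bullet> ?v \<le> 0"
    by (simp add: lagrangian_def r inner_add_left)
  then show "A *v xs + B *v ws = b"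
    by (metis eq_iff_diff_eq_0 inner_eq_zero_iff inner_ge_zero order_antisym)
qed

lemma opt_value_saddle_point:
  assumes "proper_fun g" "proper_fun f"
    and "standing_assumption g f A B b" and sp: "saddle_point g f A B b xs ws ys"
  shows "opt_value g f A B b = lagrangian g f A B b xs ws ys"
proof -
  have feas: "A *v xs + B *v ws = b"
    by (rule saddle_point_feasible_finite[OF assms])
  have "opt_value g f A B b = objective g f xs ws"
    unfolding opt_value_def
  proof (rule antisym)
    show "(INF (x, w)\<in>feasible A B b. objective g f x w) \<le> objective g f xs ws"
      using feas by (intro INF_lower2[of "(xs, ws)"]) (auto simp: feasible_def)
    show "objective g f xs ws \<le> (INF (x, w)\<in>feasible A B b. objective g f x w)"
    proof (rule INF_greatest, clarify)
      fix x w assume "(x, w) \<in> feasible A B b"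
      moreover have "lagrangian g f A B b xs ws ys \<le> lagrangian g f A B b x w ys"
        using sp by (simp add: saddle_point_def)
      ultimately show "objective g f xs ws \<le> objective g f x w"
        using feas by (simp add: feasible_def lagrangian_def zero_ereal_def[symmetric])
    qed
  qed
  then show ?thesis
    using feas by (simp add: lagrangian_def zero_ereal_def[symmetric])
qed

text \<open>If every E j exceeded the average, the sum would exceed V k1, while telescoping bounds
  it by V k1 - V (Suc N).\<close>

lemma exists_le_average:
  fixes E V :: "nat \<Rightarrow> real"
  assumes "k1 \<le> N" and step: "\<And>k. k1 \<le> k \<Longrightarrow> E k \<le> V k - V (Suc k)" and "0 \<le> V (Suc N)"
  shows "\<exists>j\<in>{k1..N}. E j \<le> V k1 / real (N - k1 + 1)"
proof (rule ccontr)
  assume contr: "\<not> ?thesis"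
  have "V k1 = (\<Sum>k\<in>{k1..N}. V k1 / real (N - k1 + 1))"
    using assms(1) by (simp add: Suc_diff_le)
  also have "\<dots> < (\<Sum>k\<in>{k1..N}. E k)"
    using contr assms(1) by (intro sum_strict_mono) (auto simp: not_le)
  also have "\<dots> \<le> (\<Sum>k\<in>{k1..N}. V k - V (Suc k))"
    by (intro sum_mono step) simp
  also have "\<dots> = V k1 - V (Suc N)"
    using sum_Suc_diff[of k1 N "\<lambda>k. - V k"] assms(1) by simp
  finally show False using assms(3) by simp
qed

lemma power2_ereal_mono:
  fixes a :: ereal
  assumes "0 \<le> a" "a \<le> ereal (sqrt c)" "0 \<le> c"
  shows "a\<^sup>2 \<le> ereal c"
proof -
  have "a\<^sup>2 \<le> ereal (sqrt c) * ereal (sqrt c)"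
    unfolding power2_eq_square using assms by (intro ereal_mult_mono) auto
  then show ?thesis using assms(3) by simp
qed

section \<open>Rates at a common index\<close>

theorem theorem4p3:
  fixes g :: "real^'q \<Rightarrow> ereal" and f :: "real^'p \<Rightarrow> ereal"
    and A :: "real^'q^'m" and B :: "real^'p^'m" and b :: "real^'m"
    and S :: "real^'q^'q" and T :: "real^'p^'p"
    and \<beta> \<psi> \<mu> :: real
    and u x :: "nat \<Rightarrow> real^'q" and w :: "nat \<Rightarrow> real^'p" and y :: "nat \<Rightarrow> real^'m"
    and \<tau> :: "nat \<Rightarrow> real"
    and xs :: "real^'q" and ws :: "real^'p" and ys :: "real^'m"
    and k1 :: nat and A0 \<tau>low Cprm :: real
  assumes "proper_fun g" "closed_fun g" "convex_fun g"
    and "proper_fun f" "closed_fun f" "convex_fun f"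
    and "standing_assumption g f A B b"
    and "saddle_point g f A B b xs ws ys"
    and "generated_by_algorithm g f A B b S T \<beta> \<psi> \<mu> u x w y \<tau>"
    and "1 \<le> k1"
    and "descent_from g f A B b S T \<beta> \<psi> \<mu> u x w y \<tau> xs ws k1"
    and "A0 = \<psi> / (\<psi> - 1) * (mnorm S (u (k1 + 1) - xs))\<^sup>2
              + (mnorm (\<tau> (k1 - 1) *\<^sub>R T) (ws - w (k1 - 1)))\<^sup>2
              + 1 / \<beta> * (norm (ys - y (k1 - 1)))\<^sup>2"
    and "\<tau>low = tau_lower A S \<mu> \<beta> (\<tau> 0)"
    and "Cprm = A0 * (1 / (\<beta> * \<tau>low\<^sup>2 * (1 - \<mu>)) + opnorm T / \<tau>low
                      + 2 * \<psi> * opnorm S * \<tau> 0 / \<tau>low ^ 3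
                      + 2 * \<beta> * (opnorm A)\<^sup>2 / (1 - \<mu>))"
  shows "\<exists>C>0. (0 < A0 \<longrightarrow> C = Cprm) \<and>
    (\<forall>N\<ge>k1. \<exists>j\<in>{k1..N}.
        lagrangian g f A B b (x j) (w j) ys - opt_value g f A B b
          \<le> ereal (A0 / (2 * \<tau>low * real (N - k1 + 1))) \<and>
        norm (A *v x j + B *v w j - b)
          \<le> sqrt (A0 / (\<beta> * \<tau>low\<^sup>2 * (1 - \<mu>) * real (N - k1 + 1))) \<and>
        dual_dist f B (w j) (y j)
          \<le> ereal (sqrt (A0 * opnorm T / (\<tau>low * real (N - k1 + 1)))) \<and>
        dual_dist g A (x j) (y j)
          \<le> ereal (sqrt (1 / real (N - k1 + 1) *
                (2 * A0 * \<psi> * opnorm S * \<tau> 0 / \<tau>low ^ 3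
                 + 2 * A0 * \<beta> * (opnorm A)\<^sup>2 / (1 - \<mu>)))) \<and>
        residual g f A B b (x j) (w j) (y j) \<le> ereal (Cprm / real (N - k1 + 1)) \<and>
        residual g f A B b (x j) (w j) (y j) \<le> ereal (C / real (N - k1 + 1)))"
proof -
  note gen = assms(9)
  have S: "spd S" and T: "spd T" and \<tau>0: "0 < \<tau> 0" and \<beta>: "0 < \<beta>"
    and \<psi>: "1 < \<psi>" and \<psi>_le: "\<psi> \<le> (1 + sqrt 5) / 2" and \<mu>: "0 < \<mu>" and \<mu>_less: "\<mu> < \<psi> / 2"
    using gen by (auto simp: generated_by_algorithm_def algorithm_params_def)
  have u_rec: "u (Suc k) = ((\<psi> - 1) / \<psi>) *\<^sub>R x k + (1 / \<psi>) *\<^sub>R u k"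
    and x_min: "is_arg_min (x_objective g A B b S (\<tau> k) (u (Suc k)) (w k) (y k)) (\<lambda>_. True) (x (Suc k))"
    and \<tau>_rec: "\<tau> (Suc k) = next_step A S \<mu> \<beta> (\<tau> k) (x k) (x (Suc k))"
    and w_min: "is_arg_min (w_objective g f A B b T (\<beta> * \<tau> (Suc k)) (x (Suc k)) (w k) (y k))
      (\<lambda>_. True) (w (Suc k))"
    and y_rec: "y (Suc k) = y k + (\<beta> * \<tau> (Suc k)) *\<^sub>R (A *v x (Suc k) + B *v w (Suc k) - b)" for k
    using gen unfolding generated_by_algorithm_def by (metis diff_Suc_1 le_add1 plus_1_eq_Suc)+
  \<comment> \<open>From sqrt 5 < 3 follows \<psi> < 2, hence \<mu> < \<psi> / 2 < 1.\<close>
  have "sqrt 5 < sqrt (9::real)" by (rule real_sqrt_less_mono) simp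
  then have \<mu>1: "0 < 1 - \<mu>" using \<mu>_less \<psi>_le by simp
  have low_pos: "0 < \<tau>low"
    using tau_lower_pos[OF S \<mu> \<beta> \<tau>0] by (simp add: assms(13))
  have low_le: "\<tau>low \<le> \<tau> k" for k
    by (induction k) (auto simp: assms(13) \<tau>_rec tau_lower_le intro: tau_lower_le_next_step[OF S \<mu> \<beta>])
  have \<tau>_pos: "0 < \<tau> k" for k
    using low_pos low_le[of k] by simp

  obtain P where P: "objective g f xs ws = ereal P"
    using saddle_point_feasible_finite(2)[OF assms(1,4,7,8)] by blast
  have optL: "opt_value g f A B b = lagrangian g f A B b xs ws ys"
    by (rule opt_value_saddle_point[OF assms(1,4,7,8)])
  have opt: "opt_value g f A B b = ereal P"
    using saddle_point_feasible_finite(1)[OF assms(1,4,7,8)]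
    by (simp add: optL lagrangian_def P)
  have P_le: "ereal P \<le> lagrangian g f A B b x' w' ys" for x' w'
    using assms(8) optL opt by (simp add: saddle_point_def)

  \<comment> \<open>E collects the terms subtracted in the descent inequality. V is indexed so that
    V k involves u (k + 1) but w, y and \<tau> at k - 1: the inequality at k then contains exactly V
    k - V (Suc k), and V k1 is A0.\<close>
  define E where "E k = (mnorm (\<tau> k *\<^sub>R T) (w k - w (k - 1)))\<^sup>2
      + 1 / \<beta> * (1 - \<mu>) * (norm (y k - y (k - 1)))\<^sup>2
      + \<psi> * \<tau> k / \<tau> (k - 1) * (mnorm S (x k - u (k + 1)))\<^sup>2" for k
  define V where "V k = \<psi> / (\<psi> - 1) * (mnorm S (u (k + 1) - xs))\<^sup>2
      + (mnorm (\<tau> (k - 1) *\<^sub>R T) (ws - w (k - 1)))\<^sup>2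
      + 1 / \<beta> * (norm (ys - y (k - 1)))\<^sup>2" for k
  have V_nonneg: "0 \<le> V k" for k
    using \<psi> \<beta> by (simp add: V_def)
  have A0: "A0 = V k1" by (simp add: assms(12) V_def)
  define l where "l k = real_of_ereal (lagrangian g f A B b (x k) (w k) ys)" for k
  have descent: "lagrangian g f A B b (x k) (w k) ys = ereal (l k)
      \<and> 2 * \<tau> k * (l k - P) + E k \<le> V k - V (Suc k)" if k: "k1 \<le> k" for k
  proof -
    \<comment> \<open>The finite right side and 2 \<tau>_k > 0 exclude the value \<infinity> for the
      Lagrangian, and \<open>P_le\<close> excludes -\<infinity>, so the inequality passes to real
      numbers.\<close>
    have *: "ereal (2 * \<tau> k) * (lagrangian g f A B b (x k) (w k) ys - ereal P)
        \<le> ereal (V k - V (Suc k) - E k)"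
      using assms(11)[unfolded descent_from_def, rule_format, OF k, of ys]
      by (simp add: V_def E_def opt algebra_simps)
    then show ?thesis
      using \<tau>_pos[of k] P_le[of "x k" "w k"]
      by (cases "lagrangian g f A B b (x k) (w k) ys") (auto simp: l_def)
  qed

  have bound: "\<exists>j\<in>{k1..N}.
      lagrangian g f A B b (x j) (w j) ys - opt_value g f A B b \<le> ereal (A0 / (2 * \<tau>low * n)) \<and>
      norm (A *v x j + B *v w j - b) \<le> sqrt (A0 / (\<beta> * \<tau>low\<^sup>2 * (1 - \<mu>) * n)) \<and>
      dual_dist f B (w j) (y j) \<le> ereal (sqrt (A0 * opnorm T / (\<tau>low * n))) \<and>
      dual_dist g A (x j) (y j) \<le> ereal (sqrt (1 / n *
        (2 * A0 * \<psi> * opnorm S * \<tau> 0 / \<tau>low ^ 3 + 2 * A0 * \<beta> * (opnorm A)\<^sup>2 / (1 - \<mu>)))) \<and>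
      residual g f A B b (x j) (w j) (y j) \<le> ereal (Cprm / n)"
    if N: "k1 \<le> N" and n: "n = real (N - k1 + 1)" for N n
  proof -
    have n_pos: "0 < n" by (simp add: n)
    define a where "a = A0 / n"
    have a_nonneg: "0 \<le> a" using V_nonneg n_pos by (simp add: a_def A0)
    \<comment> \<open>Averaging the gap and E together, not term by term, makes one index serve
      every bound.\<close>
    obtain j where j: "j \<in> {k1..N}" and Ej: "2 * \<tau> j * (l j - P) + E j \<le> a"
      using exists_le_average[OF N, of "\<lambda>k. 2 * \<tau> k * (l k - P) + E k" V] descent V_nonneg
      unfolding a_def A0 n by blast
    \<comment> \<open>Since k1 is at least 1, j has a predecessor i, which replaces the truncated j
      - 1.\<close>
    from j assms(10) obtain i where i: "j = Suc i" by (cases j) auto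
    define r dw du where "r = A *v x j + B *v w j - b"
      and "dw = w j - w i" and "du = x j - u (Suc j)"
    define qw qu where "qw = dw \<bullet> (T *v dw)" and "qu = du \<bullet> (S *v du)"
    have lj: "lagrangian g f A B b (x j) (w j) ys = ereal (l j)" using descent j by auto
    have gap: "0 \<le> l j - P" using P_le[of "x j" "w j"] by (simp add: lj)
    have q_nonneg: "0 \<le> qw" "0 \<le> qu"
      by (simp_all add: qw_def qu_def spd_inner_nonneg S T)
    have y_diff: "y j - y i = (\<beta> * \<tau> j) *\<^sub>R r" by (simp add: i r_def y_rec)
    have E_eq: "E j = \<tau> j * qw + 1 / \<beta> * (1 - \<mu>) * (norm (y j - y i))\<^sup>2 + \<psi> * \<tau> j / \<tau> i * qu"
      using \<tau>_pos[of j]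
      by (simp add: E_def i qw_def qu_def dw_def du_def mnorm_scaleR_power2[OF T] mnorm_power2[OF S])
    have parts: "0 \<le> 2 * \<tau> j * (l j - P)" "0 \<le> \<tau> j * qw"
      "0 \<le> 1 / \<beta> * (1 - \<mu>) * (norm (y j - y i))\<^sup>2" "0 \<le> \<psi> * \<tau> j / \<tau> i * qu"
      using gap q_nonneg \<tau>_pos[of i] \<tau>_pos[of j] \<beta> \<psi> \<mu>1 by simp_all
    have b1: "2 * \<tau> j * (l j - P) \<le> a" and b2: "\<tau> j * qw \<le> a"
      and b3: "1 / \<beta> * (1 - \<mu>) * (norm (y j - y i))\<^sup>2 \<le> a" and b4: "\<psi> * \<tau> j / \<tau> i * qu \<le> a"
      using Ej parts unfolding E_eq by linarith+

    have "2 * \<tau>low * (l j - P) \<le> 2 * \<tau> j * (l j - P)"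
      using gap low_le[of j] by (intro mult_right_mono) auto
    then have "2 * \<tau>low * (l j - P) \<le> a" using b1 by linarith
    then have c1: "l j - P \<le> A0 / (2 * \<tau>low * n)"
      using low_pos n_pos by (simp add: a_def field_simps)

    have y_bound: "(norm (y j - y i))\<^sup>2 \<le> \<beta> * a / (1 - \<mu>)"
      using b3 \<beta> \<mu>1 by (simp add: field_simps)
    have "(\<beta> * \<tau>low)\<^sup>2 * (norm r)\<^sup>2 \<le> (\<beta> * \<tau> j)\<^sup>2 * (norm r)\<^sup>2"
      using low_le[of j] low_pos \<beta> by (intro mult_right_mono power_mono mult_left_mono) auto
    also have "\<dots> = (norm (y j - y i))\<^sup>2"
      by (simp add: y_diff power_mult_distrib)
    also note y_bound
    finally have "(norm r)\<^sup>2 \<le> \<beta> * a / (1 - \<mu>) / (\<beta> * \<tau>low)\<^sup>2"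
      using low_pos \<beta> by (subst pos_le_divide_eq) (simp_all add: mult.commute)
    also have "\<dots> = A0 / (\<beta> * \<tau>low\<^sup>2 * (1 - \<mu>) * n)"
      using \<beta> by (simp add: a_def power2_eq_square)
    finally have c2: "(norm r)\<^sup>2 \<le> A0 / (\<beta> * \<tau>low\<^sup>2 * (1 - \<mu>) * n)" .

    obtain gj where gj: "g (x j) = ereal gj"
      using x_step_subgradient(2)[OF assms(1,3) S x_min] i by blast
    have yj: "y i + (\<beta> * \<tau> j) *\<^sub>R (A *v x j + B *v w j - b) = y j"
      by (simp add: i y_rec)
    have "- (transpose B *v y j + T *v dw) \<in> subdifferential f (w j)"
      using w_step_subgradient[OF assms(4,6) T gj w_min[of i, folded i]]
      unfolding yj dw_def .
    from dual_dist_le[OF this, of B "y j"]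
    have dw_le: "dual_dist f B (w j) (y j) \<le> ereal (norm (T *v dw))" by simp
    have "\<tau>low * qw \<le> \<tau> j * qw"
      using q_nonneg low_le[of j] by (intro mult_right_mono) auto
    then have "qw \<le> a / \<tau>low"
      using b2 low_pos by (simp add: pos_le_divide_eq mult.commute)
    then have "opnorm T * qw \<le> opnorm T * (a / \<tau>low)"
      by (intro mult_left_mono opnorm_nonneg)
    then have c3: "(norm (T *v dw))\<^sup>2 \<le> A0 * opnorm T / (\<tau>low * n)"
      using norm_spd_mult_power2_le[OF T, of dw] by (simp add: qw_def a_def mult.commute)

    \<comment> \<open>The recursion for u gives x_j - u_{j+1} = (x_j - u_j) / \<psi>. This links the
      proximal displacement of the x-step to the quantity controlled by E.\<close>
    have "x j - u j = \<psi> *\<^sub>R du"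
      using \<psi> by (simp add: du_def u_rec algebra_simps diff_divide_distrib)
    then have Sx: "(1 / \<tau> i) *\<^sub>R (S *v (x j - u j)) = (\<psi> / \<tau> i) *\<^sub>R (S *v du)"
      by (simp add: matrix_vector_mult_scaleR)
    have "- (transpose A *v y i + (\<psi> / \<tau> i) *\<^sub>R (S *v du)) \<in> subdifferential g (x j)"
      using x_step_subgradient(1)[OF assms(1,3) S x_min[of i, folded i]] unfolding Sx .
    from dual_dist_le[OF this, of A "y j"]
    have dx_le: "dual_dist g A (x j) (y j)
        \<le> ereal (norm (transpose A *v (y j - y i) - (\<psi> / \<tau> i) *\<^sub>R (S *v du)))"
      by (simp add: matrix_vector_mult_diff_distrib algebra_simps)
    have "\<psi> * qu \<le> a * \<tau> i / \<tau> j"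
      using b4 \<tau>_pos[of i] \<tau>_pos[of j] by (simp add: field_simps)
    then have "\<psi> * opnorm S / (\<tau> i)\<^sup>2 * (\<psi> * qu) \<le> \<psi> * opnorm S / (\<tau> i)\<^sup>2 * (a * \<tau> i / \<tau> j)"
      using \<psi> by (intro mult_left_mono) (auto simp: opnorm_nonneg)
    also have "\<dots> = \<psi> * opnorm S * a / (\<tau> i * \<tau> j)"
      using \<tau>_pos[of i] by (simp add: power2_eq_square)
    also have "\<dots> \<le> \<psi> * opnorm S * a / (\<tau>low * \<tau>low)"
      using \<psi> low_pos low_le a_nonneg \<tau>_pos
      by (intro divide_left_mono mult_mono) (auto simp: opnorm_nonneg intro: less_imp_le)
    \<comment> \<open>The estimate by the inverse square of \<tau>low is deliberately weakened
      through \<tau>low \<le> \<tau>_0, to reach the stated constant with a cube.\<close>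
    also have "\<dots> = \<psi> * opnorm S * a / \<tau>low ^ 3 * \<tau>low"
      using low_pos by (simp add: power3_eq_cube)
    also have "\<dots> \<le> \<psi> * opnorm S * a / \<tau>low ^ 3 * \<tau> 0"
      using \<psi> low_pos low_le a_nonneg by (intro mult_left_mono) (auto simp: opnorm_nonneg)
    finally have Su: "(\<psi> / \<tau> i)\<^sup>2 * (opnorm S * qu) \<le> \<psi> * opnorm S * a / \<tau>low ^ 3 * \<tau> 0"
      by (simp add: power2_eq_square mult_ac)
    have Su': "(norm ((\<psi> / \<tau> i) *\<^sub>R (S *v du)))\<^sup>2 \<le> \<psi> * opnorm S * a / \<tau>low ^ 3 * \<tau> 0"
    proof -
      have "(norm ((\<psi> / \<tau> i) *\<^sub>R (S *v du)))\<^sup>2 = (\<psi> / \<tau> i)\<^sup>2 * (norm (S *v du))\<^sup>2"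
        by (simp add: power_mult_distrib power_divide)
      also have "\<dots> \<le> (\<psi> / \<tau> i)\<^sup>2 * (opnorm S * qu)"
        unfolding qu_def by (intro mult_left_mono norm_spd_mult_power2_le S) simp
      finally show ?thesis using Su by linarith
    qed
    have Ay: "(norm (transpose A *v (y j - y i)))\<^sup>2 \<le> (opnorm A)\<^sup>2 * (\<beta> * a / (1 - \<mu>))"
    proof -
      have "(norm (transpose A *v (y j - y i)))\<^sup>2 \<le> (opnorm A * norm (y j - y i))\<^sup>2"
        by (intro power_mono norm_transpose_mult_le) simp
      also have "\<dots> \<le> (opnorm A)\<^sup>2 * (\<beta> * a / (1 - \<mu>))"
        unfolding power_mult_distrib by (intro mult_left_mono y_bound) simp
      finally show ?thesis .
    qed
    \<comment> \<open>The parallelogram law is the source of the factor 2 in both terms of the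
      x-bound.\<close>
    have "(norm (p - s))\<^sup>2 \<le> 2 * (norm p)\<^sup>2 + 2 * (norm s)\<^sup>2" for p s :: "real^'q"
      using zero_le_power2[of "norm (p + s)"]
      by (simp add: power2_norm_eq_inner inner_diff_left inner_diff_right inner_add_left
          inner_add_right inner_commute del: zero_le_power2)
    from this[of "transpose A *v (y j - y i)" "(\<psi> / \<tau> i) *\<^sub>R (S *v du)"]
    have "(norm (transpose A *v (y j - y i) - (\<psi> / \<tau> i) *\<^sub>R (S *v du)))\<^sup>2
        \<le> 2 * ((opnorm A)\<^sup>2 * (\<beta> * a / (1 - \<mu>))) + 2 * (\<psi> * opnorm S * a / \<tau>low ^ 3 * \<tau> 0)"
      using Su' Ay by linarith
    also have "\<dots> = 1 / n * (2 * A0 * \<psi> * opnorm S * \<tau> 0 / \<tau>low ^ 3 + 2 * A0 * \<beta> * (opnorm A)\<^sup>2 / (1 - \<mu>))"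
      by (simp add: a_def algebra_simps)
    finally have c4: "(norm (transpose A *v (y j - y i) - (\<psi> / \<tau> i) *\<^sub>R (S *v du)))\<^sup>2 \<le> \<dots>" .

    let ?c2 = "A0 / (\<beta> * \<tau>low\<^sup>2 * (1 - \<mu>) * n)" and ?c3 = "A0 * opnorm T / (\<tau>low * n)"
      and ?c4 = "1 / n * (2 * A0 * \<psi> * opnorm S * \<tau> 0 / \<tau>low ^ 3 + 2 * A0 * \<beta> * (opnorm A)\<^sup>2 / (1 - \<mu>))"
    have d3: "dual_dist f B (w j) (y j) \<le> ereal (sqrt ?c3)"
      using dw_le c3 by (meson ereal_less_eq(3) order_trans real_le_rsqrt)
    have d4: "dual_dist g A (x j) (y j) \<le> ereal (sqrt ?c4)"
      using dx_le c4 by (meson ereal_less_eq(3) order_trans real_le_rsqrt)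
    have "residual g f A B b (x j) (w j) (y j) \<le> ereal ?c2 + ereal ?c4 + ereal ?c3"
      unfolding residual_def
      using c2 order_trans[OF zero_le_power2 c3] order_trans[OF zero_le_power2 c4] d3 d4
      by (intro add_mono power2_ereal_mono dual_dist_nonneg) (auto simp: r_def)
    also have "\<dots> = ereal (Cprm / n)"
      by (simp add: assms(14) algebra_simps add_divide_distrib)
    finally have d5: "residual g f A B b (x j) (w j) (y j) \<le> ereal (Cprm / n)" .
    show ?thesis
      using j c1 real_le_rsqrt[OF c2] d3 d4 d5
      by (intro bexI[of _ j]) (auto simp: lj opt r_def)
  qed

  \<comment> \<open>When A0 = 0, Cprm vanishes and cannot serve as a positive constant; any positive
    number then works, here 1.\<close>
  define C where "C = (if 0 < A0 then Cprm else 1)"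
  have "0 < 1 / (\<beta> * \<tau>low\<^sup>2 * (1 - \<mu>))"
    using \<beta> low_pos \<mu>1 by simp
  moreover have "0 \<le> opnorm T / \<tau>low" "0 \<le> 2 * \<psi> * opnorm S * \<tau> 0 / \<tau>low ^ 3"
    "0 \<le> 2 * \<beta> * (opnorm A)\<^sup>2 / (1 - \<mu>)"
    using \<beta> low_pos \<mu>1 \<tau>0 \<psi> by (simp_all add: opnorm_nonneg)
  ultimately have "0 < A0 \<Longrightarrow> 0 < Cprm"
    unfolding assms(14) by (intro mult_pos_pos) linarith+
  then have C_pos: "0 < C" by (simp add: C_def)
  have "\<not> 0 < A0 \<Longrightarrow> A0 = 0" using V_nonneg[of k1] by (simp add: A0)
  then have "Cprm \<le> C" by (auto simp: C_def assms(14))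
  then have CN: "ereal (Cprm / real (N - k1 + 1)) \<le> ereal (C / real (N - k1 + 1))" for N
    by (simp add: divide_right_mono)
  show ?thesis
  proof (intro exI[of _ C] conjI allI impI)
    show "0 < A0 \<Longrightarrow> C = Cprm" by (simp add: C_def)
  qed (use C_pos bound[OF _ refl] order_trans[OF _ CN] in \<open>blast+\<close>)
qed

end
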